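(* Let $\mathcal{A}\in\mathbb{C}^{n_1\times n_1\times n_3}$. Suppose $\mathcal{A}$ has the C-HS decomposition $$\mathcal{A}=\mathcal{U}*_c\begin{bmatrix}\mathcal{S}_r*_c\mathcal{K} & \mathcal{S}_r*_c\mathcal{L}\\ \mathcal{O}&\mathcal{O}\end{bmatrix}*_c\mathcal{U}^H.$$ Then $$\mathcal{A}^\dagger=\mathcal{U}*_c\begin{bmatrix}\mathcal{K}^H*_c\mathcal{S}_r^{-1} & \mathcal{O}\\ \mathcal{L}^H*_c\mathcal{S}_r^{-1}&\mathcal{O}\end{bmatrix}*_c\mathcal{U}^H.$$
   Context: For a third-order tensor $\mathcal{A}\in\mathbb{C}^{n_1\times n_2\times n_3}$, $\mathcal{A}^{(i)}=\mathcal{A}(:,:,i)\in\mathbb{C}^{n_1\times n_2}$ denotes its $i$-th frontal slice. Let $\mathbf{C}_{n_3}$ be the $n_3\times n_3$ orthogonal DCT matrix, with entries $(\mathbf{C}_{n_3})_{jk}=\sqrt{(2-\delta_{j1})/n_3}\,\cos\big(\tfrac{(j-1)(2k-1)\pi}{2n_3}\big)$; let $\mathbf{W}$ be the diagonal matrix whose diagonal is the first column of $\mathbf{C}_{n_3}$; let $\mathbf{Z}$ be the $n_3\times n_3$ matrix with ones on the first superdiagonal and zeros elsewhere; and put $\mathbf{M}=\mathbf{W}^{-1}\mathbf{C}_{n_3}(\mathbf{I}+\mathbf{Z})$, an invertible matrix. Define the linear bijection $L$ on tensors with third dimension $n_3$ by $L(\mathcal{A})_{ijk}=\sum_{l=1}^{n_3}\mathbf{M}_{kl}\mathcal{A}_{ijl}$.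 The C-product of $\mathcal{A}\in\mathbb{C}^{n_1\times n_2\times n_3}$ and $\mathcal{B}\in\mathbb{C}^{n_2\times l\times n_3}$ is the tensor $\mathcal{A}*_c\mathcal{B}\in\mathbb{C}^{n_1\times l\times n_3}$ determined by $L(\mathcal{A}*_c\mathcal{B})^{(i)}=L(\mathcal{A})^{(i)}L(\mathcal{B})^{(i)}$, $i=1,\dots,n_3$. The conjugate transpose $\mathcal{A}^H$ is determined by $L(\mathcal{A}^H)^{(i)}=(L(\mathcal{A})^{(i)})^H$ for all $i$. The identity tensor $\mathcal{I}\in\mathbb{C}^{n\times n\times n_3}$ is determined by $L(\mathcal{I})^{(i)}=\mathbf{I}_n$ for all $i$. The inverse $\mathcal{B}^{-1}$ of $\mathcal{B}\in\mathbb{C}^{n\times n\times n_3}$ is the tensor with $\mathcal{B}*_c\mathcal{B}^{-1}=\mathcal{B}^{-1}*_c\mathcal{B}=\mathcal{I}$. $\mathcal{Q}\in\mathbb{C}^{n\times n\times n_3}$ is unitary if $\mathcal{Q}^H*_c\mathcal{Q}=\mathcal{Q}*_c\mathcal{Q}^H=\mathcal{I}$. A tensor is F-diagonal if all its frontal slices are diagonal. Block notation partitions tensors along the first two modes; $\mathcal{O}$ denotes zero tensors. C-HS decomposition: let $\mathcal{A}\in\mathbb{C}^{n_1\times n_1\times n_3}$ have a C-SVD $\mathcal{A}=\mathcal{U}*_c\mathcal{S}*_c\mathcal{V}^H$ ($\mathcal{U},\mathcal{V}\in\mathbb{C}^{n_1\times n_1\times n_3}$ unitary, $\mathcal{S}$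 F-diagonal) in which all $L(\mathcal{S})^{(i)}$, $i=1,\dots,n_3$, have the same rank $r$, so that $\mathcal{S}=\begin{bmatrix}\mathcal{S}_r&\mathcal{O}\\ \mathcal{O}&\mathcal{O}\end{bmatrix}$ with $\mathcal{S}_r\in\mathbb{C}^{r\times r\times n_3}$ F-diagonal and invertible. Write $\mathcal{V}^H*_c\mathcal{U}=\begin{bmatrix}\mathcal{K}&\mathcal{L}\\ \mathcal{M}&\mathcal{N}\end{bmatrix}$ with $\mathcal{K}\in\mathbb{C}^{r\times r\times n_3}$, $\mathcal{L}\in\mathbb{C}^{r\times(n_1-r)\times n_3}$. Then $\mathcal{A}=\mathcal{U}*_c\begin{bmatrix}\mathcal{S}_r*_c\mathcal{K}&\mathcal{S}_r*_c\mathcal{L}\\ \mathcal{O}&\mathcal{O}\end{bmatrix}*_c\mathcal{U}^H$ with $\mathcal{K}*_c\mathcal{K}^H+\mathcal{L}*_c\mathcal{L}^H=\mathcal{I}_r$ (the identity tensor in $\mathbb{C}^{r\times r\times n_3}$); this is called the C-HS decomposition of $\mathcal{A}$. The Moore-Penrose inverse $\mathcal{A}^\dagger$ is the (unique) tensor $\mathcal{X}$ with $\mathcal{A}*_c\mathcal{X}*_c\mathcal{A}=\mathcal{A}$, $\mathcal{X}*_c\mathcal{A}*_c\mathcal{X}=\mathcal{X}$, $(\mathcal{A}*_c\mathcal{X})^H=\mathcal{A}*_c\mathcal{X}$, $(\mathcal{X}*_c\mathcal{A})^H=\mathcal{X}*_c\mathcal{A}$. *)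

theory Defs
  imports
    Complex_Main
    "Jordan_Normal_Form.Matrix"
    "Jordan_Normal_Form.Gauss_Jordan_Elimination"
    "Jordan_Normal_Form.Schur_Decomposition"
    "Jordan_Normal_Form.DL_Rank"
begin

text \<open>A third-order complex tensor is the list of its frontal slices, so the number of slices is
  the length of the list. All indices are 0-based. The operations below read the first two
  dimensions off the first slice, so they are meaningful for at least one slice; the first two
  dimensions may be 0.\<close>

type_synonym tensor = "complex mat list"

definition carrier_tensor :: "nat \<Rightarrow> nat \<Rightarrow> nat \<Rightarrow> tensor set" where
  "carrier_tensor n1 n2 n3 = {A. length A = n3 \<and> (\<forall>i<n3. A ! i \<in> carrier_mat n1 n2)}"

definition tdim1 :: "tensor \<Rightarrow> nat" where
  "tdim1 A = dim_row (A ! 0)"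

definition tdim2 :: "tensor \<Rightarrow> nat" where
  "tdim2 A = dim_col (A ! 0)"

definition tzero :: "nat \<Rightarrow> nat \<Rightarrow> nat \<Rightarrow> tensor" where
  "tzero n1 n2 n3 = replicate n3 (0\<^sub>m n1 n2)"

definition tplus :: "tensor \<Rightarrow> tensor \<Rightarrow> tensor" (infixl "+\<^sub>c" 65) where
  "A +\<^sub>c B = map (\<lambda>i. A ! i + B ! i) [0..<length A]"

definition tblock :: "tensor \<Rightarrow> tensor \<Rightarrow> tensor \<Rightarrow> tensor \<Rightarrow> tensor" where
  "tblock A B C D = map (\<lambda>i. four_block_mat (A ! i) (B ! i) (C ! i) (D ! i)) [0..<length A]"

definition f_diagonal :: "tensor \<Rightarrow> bool" where
  "f_diagonal A \<longleftrightarrow> (\<forall>i<length A. diagonal_mat (A ! i))"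

text \<open>The orthogonal DCT matrix; with 0-based \<open>j\<close> and \<open>k\<close> the argument of the cosine is
  \<open>j (2 k + 1) pi / (2 n)\<close>.\<close>

definition dct_mat :: "nat \<Rightarrow> complex mat" where
  "dct_mat n = mat n n (\<lambda>(j, k). complex_of_real
     (sqrt ((2 - (if j = 0 then 1 else 0)) / real n) *
      cos (real (j * (2 * k + 1)) * pi / (2 * real n))))"

definition dct_W :: "nat \<Rightarrow> complex mat" where
  "dct_W n = mat_diag n (\<lambda>j. dct_mat n $$ (j, 0))"

definition shift_Z :: "nat \<Rightarrow> complex mat" where
  "shift_Z n = mat n n (\<lambda>(j, k). if k = Suc j then 1 else 0)"

definition M_mat :: "nat \<Rightarrow> complex mat" where
  "M_mat n = the (mat_inverse (dct_W n)) * dct_mat n * (1\<^sub>m n + shift_Z n)"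

definition L_trans :: "tensor \<Rightarrow> tensor" where
  "L_trans A = map (\<lambda>k. mat (tdim1 A) (tdim2 A)
     (\<lambda>(i, j). \<Sum>l<length A. M_mat (length A) $$ (k, l) * (A ! l) $$ (i, j))) [0..<length A]"

text \<open>For at least one slice the matrix \<open>M_mat\<close> is invertible, hence \<open>L_trans\<close> is a bijection on
  each \<open>carrier_tensor\<close> and the descriptions in the next three definitions have exactly one
  solution.\<close>

definition c_prod :: "tensor \<Rightarrow> tensor \<Rightarrow> tensor" (infixl "*\<^sub>c" 70) where
  "A *\<^sub>c B = (THE C. C \<in> carrier_tensor (tdim1 A) (tdim2 B) (length A) \<and>
     (\<forall>i<length A. L_trans C ! i = L_trans A ! i * L_trans B ! i))"

definition t_herm :: "tensor \<Rightarrow> tensor" where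
  "t_herm A = (THE B. B \<in> carrier_tensor (tdim2 A) (tdim1 A) (length A) \<and>
     (\<forall>i<length A. L_trans B ! i = mat_adjoint (L_trans A ! i)))"

definition t_one :: "nat \<Rightarrow> nat \<Rightarrow> tensor" where
  "t_one n n3 = (THE B. B \<in> carrier_tensor n n n3 \<and> (\<forall>i<n3. L_trans B ! i = 1\<^sub>m n))"

definition is_t_inverse :: "tensor \<Rightarrow> tensor \<Rightarrow> bool" where
  "is_t_inverse B X \<longleftrightarrow> X \<in> carrier_tensor (tdim1 B) (tdim1 B) (length B) \<and>
     B *\<^sub>c X = t_one (tdim1 B) (length B) \<and> X *\<^sub>c B = t_one (tdim1 B) (length B)"

definition t_invertible :: "tensor \<Rightarrow> bool" where
  "t_invertible B \<longleftrightarrow> (\<exists>X. is_t_inverse B X)"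

definition t_inv :: "tensor \<Rightarrow> tensor" where
  "t_inv B = (THE X. is_t_inverse B X)"

definition t_unitary :: "nat \<Rightarrow> nat \<Rightarrow> tensor \<Rightarrow> bool" where
  "t_unitary n n3 Q \<longleftrightarrow> Q \<in> carrier_tensor n n n3 \<and>
     t_herm Q *\<^sub>c Q = t_one n n3 \<and> Q *\<^sub>c t_herm Q = t_one n n3"

definition is_moore_penrose :: "tensor \<Rightarrow> tensor \<Rightarrow> bool" where
  "is_moore_penrose A X \<longleftrightarrow> X \<in> carrier_tensor (tdim2 A) (tdim1 A) (length A) \<and>
     A *\<^sub>c X *\<^sub>c A = A \<and> X *\<^sub>c A *\<^sub>c X = X \<and>
     t_herm (A *\<^sub>c X) = A *\<^sub>c X \<and> t_herm (X *\<^sub>c A) = X *\<^sub>c A"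

definition moore_penrose :: "tensor \<Rightarrow> tensor" where
  "moore_penrose A = (THE X. is_moore_penrose A X)"

definition is_c_svd :: "nat \<Rightarrow> nat \<Rightarrow> tensor \<Rightarrow> tensor \<Rightarrow> tensor \<Rightarrow> tensor \<Rightarrow> bool" where
  "is_c_svd n n3 A U S V \<longleftrightarrow> t_unitary n n3 U \<and> t_unitary n n3 V \<and>
     S \<in> carrier_tensor n n n3 \<and> f_diagonal S \<and> A = U *\<^sub>c S *\<^sub>c t_herm V"

text \<open>The tensors \<open>Sr\<close>, \<open>K\<close>, \<open>L\<close> come from a C-SVD of \<open>A\<close> all of whose transformed slices have
  rank \<open>r\<close>. The last two conjuncts, the displayed factorization and the relation between
  \<open>K\<close> and \<open>L\<close>, are consequences of the others; they are listed because they are what is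
  called the decomposition.\<close>

definition is_c_hs ::
  "nat \<Rightarrow> nat \<Rightarrow> nat \<Rightarrow> tensor \<Rightarrow> tensor \<Rightarrow> tensor \<Rightarrow> tensor \<Rightarrow> tensor \<Rightarrow> bool" where
  "is_c_hs n n3 r A U Sr K L \<longleftrightarrow>
     r \<le> n \<and>
     (\<exists>V S M N.
        is_c_svd n n3 A U S V \<and>
        (\<forall>i<n3. vec_space.rank n (L_trans S ! i) = r) \<and>
        Sr \<in> carrier_tensor r r n3 \<and> f_diagonal Sr \<and> t_invertible Sr \<and>
        S = tblock Sr (tzero r (n - r) n3) (tzero (n - r) r n3) (tzero (n - r) (n - r) n3) \<and>
        K \<in> carrier_tensor r r n3 \<and> L \<in> carrier_tensor r (n - r) n3 \<and>
        M \<in> carrier_tensor (n - r) r n3 \<and> N \<in> carrier_tensor (n - r) (n - r) n3 \<and>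
        t_herm V *\<^sub>c U = tblock K L M N) \<and>
     A = U *\<^sub>c tblock (Sr *\<^sub>c K) (Sr *\<^sub>c L) (tzero (n - r) r n3) (tzero (n - r) (n - r) n3)
           *\<^sub>c t_herm U \<and>
     K *\<^sub>c t_herm K +\<^sub>c L *\<^sub>c t_herm L = t_one r n3"

end

theory Submission
  imports Defs
begin

text \<open>The transform \<^const>\<open>L_trans\<close> turns every tensor operation into the matrix operation on
  corresponding slices, so the formula is a statement about matrices, one for each transformed slice.
  What has to be supplied is that the transform is a bijection, which also gives the definite
  descriptions in the operations their meaning: the rows of the DCT matrix are orthonormal
  (\<open>dct_mat_orthogonal\<close>, a telescoping cosine sum), the diagonal scaling has no zero entry, and
  \<open>I + Z\<close> is unitriangular, so \<^const>\<open>M_mat\<close> is invertible (\<open>M_mat_invertible\<close>). Hence tensors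
  are determined by their transformed slices, and any family of slices occurs
  (\<open>tensor_eqI\<close>, \<open>tensor_with_slices\<close>).

  For a single slice put \<open>B = [S K, S L; 0, 0]\<close> and \<open>X = [K\<^sup>* S\<inverse>, 0; L\<^sup>* S\<inverse>, 0]\<close>. The relation
  \<open>K K\<^sup>* + L L\<^sup>* = I\<close> gives \<open>B X = [I, 0; 0, 0]\<close>, while \<open>X B\<close> is the Gram matrix
  \<open>[K, L]\<^sup>* [K, L]\<close>. Both products are Hermitian, and since \<open>B\<close> lives in the first block row and
  \<open>X\<close> in the first block column, \<open>B X B = B\<close> and \<open>X B X = X\<close> (\<open>penrose_mat_hs_block\<close>).
  Conjugation by a unitary matrix preserves the Penrose equations
  (\<open>penrose_mat_unitary_conj\<close>), and their solution is unique
  (\<open>penrose_mat_unique\<close>).\<close>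

section \<open>Invertibility of the transform\<close>

text \<open>The DCT matrix has entries proportional to \<open>cos (j \<theta>\<^sub>k)\<close>, where \<open>cos \<theta>\<^sub>k\<close> runs through the
  zeros of the \<open>n\<close>-th Chebyshev polynomial; these are the angles \<open>\<theta>\<^sub>k\<close>.\<close>

definition dct_angle :: "nat \<Rightarrow> nat \<Rightarrow> real" where
  "dct_angle n k = real (2 * k + 1) * pi / (2 * real n)"

text \<open>Multiplied by \<open>2 sin (m \<pi> / (2 n))\<close>, the sum telescopes to \<open>sin (m \<pi>) - sin 0 = 0\<close>. The bounds
  on \<open>m\<close> keep this factor away from zero.\<close>

lemma dct_cos_sum_eq_zero:
  fixes m n :: nat
  assumes "0 < m" "m < 2 * n"
  shows "(\<Sum>k<n. cos (real m * dct_angle n k)) = 0"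
proof -
  define t where "t = real m * pi / (2 * real n)"
  have n: "n > 0" using assms by simp
  have "0 < t" "t < pi"
    using assms n by (auto simp: t_def field_simps)
  then have "sin t > 0" by (rule sin_gt_zero)
  have step: "2 * sin t * cos (real m * dct_angle n k)
      = sin (2 * real (Suc k) * t) - sin (2 * real k * t)" for k
  proof -
    have "real m * dct_angle n k = 2 * real k * t + t"
      by (simp add: t_def dct_angle_def add_divide_distrib distrib_left distrib_right)
    moreover have "2 * real (Suc k) * t = (2 * real k * t + t) + t"
      by (simp add: distrib_right)
    moreover have "2 * real k * t = (2 * real k * t + t) - t"
      by simp
    moreover have "sin (x + t) - sin (x - t) = 2 * sin t * cos x" for x
      by (simp add: sin_add sin_diff)
    ultimately show ?thesis by metis
  qed
  have "2 * sin t * (\<Sum>k<n. cos (real m * dct_angle n k))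
      = (\<Sum>k<n. sin (2 * real (Suc k) * t) - sin (2 * real k * t))"
    by (simp only: sum_distrib_left step)
  also have "\<dots> = sin (2 * real n * t)"
    by (subst sum_lessThan_telescope) simp
  also have "2 * real n * t = real m * pi"
    using n by (simp add: t_def)
  finally show ?thesis using \<open>sin t > 0\<close> by simp
qed

text \<open>The product formula for cosines splits the sum into the cosine sums of the frequencies
  \<open>j - i\<close> and \<open>j + i\<close>, both below \<open>2 n\<close>, which vanish unless the frequency is \<open>0\<close>.\<close>

lemma dct_cos_orthogonal:
  fixes i j n :: nat
  assumes "i < n" "j < n"
  shows "(\<Sum>k<n. cos (real i * dct_angle n k) * cos (real j * dct_angle n k))
    = (if i \<noteq> j then 0 else if i = 0 then real n else real n / 2)"
  using assms
proof (induction i j rule: linorder_wlog)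
  case (le i j)
  define S where "S m = (\<Sum>k<n. cos (real m * dct_angle n k))" for m :: nat
  have S: "S m = (if m = 0 then real n else 0)" if "m < 2 * n" for m
    using that dct_cos_sum_eq_zero[of m n] by (auto simp: S_def)
  have prod: "cos (real i * x) * cos (real j * x)
      = (cos (real (j - i) * x) + cos (real (j + i) * x)) / 2" for x
  proof -
    have "real (j - i) * x = real j * x - real i * x" "real (j + i) * x = real j * x + real i * x"
      using le(1) by (simp_all add: of_nat_diff left_diff_distrib distrib_right)
    then show ?thesis
      by (subst mult.commute) (simp only: cos_times_cos)
  qed
  have "(\<Sum>k<n. cos (real i * dct_angle n k) * cos (real j * dct_angle n k))
      = (S (j - i) + S (j + i)) / 2"
    by (simp only: prod S_def sum_divide_distrib[symmetric] sum.distrib)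
  also have "\<dots> = (if i \<noteq> j then 0 else if i = 0 then real n else real n / 2)"
    using le by (subst (1 2) S) auto
  finally show ?case .
next
  case (sym i j)
  have "(\<Sum>k<n. cos (real j * dct_angle n k) * cos (real i * dct_angle n k))
      = (\<Sum>k<n. cos (real i * dct_angle n k) * cos (real j * dct_angle n k))"
    by (simp only: mult.commute)
  with sym show ?case by auto
qed

lemma dct_mat_carrier: "dct_mat n \<in> carrier_mat n n"
  unfolding dct_mat_def by (rule mat_carrier)

lemma dct_mat_orthogonal: "dct_mat n * transpose_mat (dct_mat n) = 1\<^sub>m n"
proof (rule eq_matI)
  fix i j
  assume "i < dim_row (1\<^sub>m n :: complex mat)" "j < dim_col (1\<^sub>m n :: complex mat)"
  then have ij: "i < n" "j < n" by auto
  note dims = carrier_matD[OF dct_mat_carrier[of n]]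
  define s where "s l = sqrt ((2 - (if l = 0 then 1 else 0)) / real n)" for l :: nat
  have entry: "dct_mat n $$ (l, k) = complex_of_real (s l * cos (real l * dct_angle n k))"
    if "l < n" "k < n" for l k
  proof -
    have "real (l * (2 * k + 1)) * pi / (2 * real n) = real l * dct_angle n k"
      by (simp only: dct_angle_def of_nat_mult times_divide_eq_right mult.assoc)
    with that show ?thesis by (simp only: dct_mat_def s_def index_mat split)
  qed
  have "(dct_mat n * transpose_mat (dct_mat n)) $$ (i, j)
      = (\<Sum>k<n. dct_mat n $$ (i, k) * dct_mat n $$ (j, k))"
    using ij dims by (simp add: scalar_prod_def atLeast0LessThan)
  also have "\<dots> = (\<Sum>k<n. complex_of_real (s i * s j *
      (cos (real i * dct_angle n k) * cos (real j * dct_angle n k))))"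
    using ij by (intro sum.cong) (simp_all add: entry)
  also have "\<dots> = complex_of_real (s i * s j *
      (\<Sum>k<n. cos (real i * dct_angle n k) * cos (real j * dct_angle n k)))"
    by (simp only: of_real_sum sum_distrib_left)
  also have "s i * s j * (\<Sum>k<n. cos (real i * dct_angle n k) * cos (real j * dct_angle n k))
      = (if i = j then 1 else 0)"
    unfolding dct_cos_orthogonal[OF ij] using ij by (auto simp: s_def)
  also have "complex_of_real (if i = j then 1 else 0) = 1\<^sub>m n $$ (i, j)"
    using ij by simp
  finally show "(dct_mat n * transpose_mat (dct_mat n)) $$ (i, j) = 1\<^sub>m n $$ (i, j)" .
qed (use carrier_matD[OF dct_mat_carrier[of n]] in simp_all)

lemma det_dct_mat: "det (dct_mat n) \<noteq> 0"
proof -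
  have "transpose_mat (dct_mat n) \<in> carrier_mat n n"
    using dct_mat_carrier by (rule transpose_carrier_mat[THEN iffD2])
  from det_mult[OF dct_mat_carrier this]
  have "det (dct_mat n) * det (transpose_mat (dct_mat n)) = 1"
    unfolding dct_mat_orthogonal det_one by (rule sym)
  then show ?thesis by (metis mult_zero_left zero_neq_one)
qed

lemma dct_mat_first_column:
  assumes "j < n"
  shows "dct_mat n $$ (j, 0) \<noteq> 0"
proof -
  have "0 \<le> real j * pi / (2 * real n)" "real j * pi / (2 * real n) < pi / 2"
    using assms by (auto simp: field_simps)
  then have "cos (real j * pi / (2 * real n)) > 0"
    by (intro cos_gt_zero_pi) (use pi_gt_zero in linarith)+
  then show ?thesis using assms by (simp add: dct_mat_def)
qed

text \<open>The definition of \<^const>\<open>M_mat\<close> applies \<^const>\<open>the\<close> to the computed inverse; this shows that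
  the computation succeeds and what the result satisfies.\<close>

lemma dct_W_inverse:
  obtains W where "mat_inverse (dct_W n) = Some W" "W \<in> carrier_mat n n" "dct_W n * W = 1\<^sub>m n"
proof -
  define V where "V = mat_diag n (\<lambda>j. inverse (dct_mat n $$ (j, 0)))"
  have "dct_W n * V = 1\<^sub>m n" "V * dct_W n = 1\<^sub>m n"
    unfolding dct_W_def V_def mat_diag_diag
    by (auto simp: mat_diag_def dct_mat_first_column intro!: eq_matI)
  moreover have W: "dct_W n \<in> carrier_mat n n" and "V \<in> carrier_mat n n"
    by (simp_all add: dct_W_def V_def)
  ultimately have "dct_W n \<in> Units (ring_mat TYPE(complex) n ())"
    by (auto simp: Units_def ring_mat_simps)
  then obtain X where "mat_inverse (dct_W n) = Some X"
    using mat_inverse(1)[OF W, of "()"] by (cases "mat_inverse (dct_W n)") auto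
  with mat_inverse(2)[OF W this] that show thesis by blast
qed

lemma det_one_plus_shift: "det (1\<^sub>m n + shift_Z n) = 1"
proof -
  have "upper_triangular (1\<^sub>m n + shift_Z n)" "1\<^sub>m n + shift_Z n \<in> carrier_mat n n"
    by (auto simp: shift_Z_def)
  then have "det (1\<^sub>m n + shift_Z n) = prod_list (diag_mat (1\<^sub>m n + shift_Z n))"
    by (rule det_upper_triangular)
  also have "diag_mat (1\<^sub>m n + shift_Z n) = map (\<lambda>i. 1) [0..<n]"
    by (auto simp: diag_mat_def shift_Z_def)
  also have "prod_list (map (\<lambda>i. 1 :: complex) [0..<n]) = 1"
    by (induction n) auto
  finally show ?thesis .
qed

lemma M_mat_invertible:
  obtains N where "N \<in> carrier_mat n n" "M_mat n \<in> carrier_mat n n"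
    "M_mat n * N = 1\<^sub>m n" "N * M_mat n = 1\<^sub>m n"
proof -
  obtain W where W: "mat_inverse (dct_W n) = Some W" "W \<in> carrier_mat n n" "dct_W n * W = 1\<^sub>m n"
    by (rule dct_W_inverse)
  have Wn: "dct_W n \<in> carrier_mat n n" by (simp add: dct_W_def)
  have "det W \<noteq> 0"
    using det_mult[OF Wn W(2)] W(3) by auto
  have Z: "1\<^sub>m n + shift_Z n \<in> carrier_mat n n" by (simp add: shift_Z_def)
  have M: "M_mat n = W * dct_mat n * (1\<^sub>m n + shift_Z n)"
    by (simp add: M_mat_def W(1))
  have Mc: "M_mat n \<in> carrier_mat n n"
    unfolding M using W(2) Z dct_mat_carrier[of n] by (intro mult_carrier_mat)
  have "det (M_mat n) = det W * det (dct_mat n) * det (1\<^sub>m n + shift_Z n)"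
    unfolding M using W(2) Z dct_mat_carrier[of n] by (simp add: det_mult[of _ n] mult_carrier_mat[of _ n n])
  then have "det (M_mat n) \<noteq> 0"
    using \<open>det W \<noteq> 0\<close> det_dct_mat det_one_plus_shift by simp
  from det_non_zero_imp_unit[OF Mc this, of "()"] that Mc show thesis
    by (auto simp: Units_def ring_mat_simps)
qed

section \<open>Tensors are determined by their transformed slices\<close>

lemma carrier_tensor_dims:
  assumes "A \<in> carrier_tensor p q n" "n > 0"
  shows "tdim1 A = p" "tdim2 A = q" "length A = n"
  using assms by (auto simp: carrier_tensor_def tdim1_def tdim2_def)

lemma L_trans_slice:
  assumes "A \<in> carrier_tensor p q n" "n > 0" "k < n"
  shows "L_trans A ! k = mat p q (\<lambda>(i, j). \<Sum>l<n. M_mat n $$ (k, l) * (A ! l) $$ (i, j))"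
  using assms carrier_tensor_dims[OF assms(1,2)] by (simp add: L_trans_def)

lemma L_trans_slice_carrier:
  assumes "A \<in> carrier_tensor p q n" "n > 0" "k < n"
  shows "L_trans A ! k \<in> carrier_mat p q"
  by (simp add: L_trans_slice[OF assms])

lemma index_mult_square:
  assumes "A \<in> carrier_mat n n" "B \<in> carrier_mat n n" "i < n" "j < n"
  shows "(A * B) $$ (i, j) = (\<Sum>l<n. A $$ (i, l) * B $$ (l, j))"
  using assms by (auto simp: scalar_prod_def atLeast0LessThan)

text \<open>Inversion of the transform at a fixed position \<open>(i, j)\<close> of the slices, where \<open>f\<close> is the tube
  of entries at that position.\<close>

lemma apply_mat_inverse:
  fixes N M :: "complex mat"
  assumes "N \<in> carrier_mat n n" "M \<in> carrier_mat n n" "N * M = 1\<^sub>m n" "k < n"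
  shows "(\<Sum>l<n. N $$ (k, l) * (\<Sum>m<n. M $$ (l, m) * f m)) = f k"
proof -
  have "(\<Sum>l<n. N $$ (k, l) * (\<Sum>m<n. M $$ (l, m) * f m))
      = (\<Sum>l<n. \<Sum>m<n. N $$ (k, l) * M $$ (l, m) * f m)"
    by (simp add: sum_distrib_left mult.assoc)
  also have "\<dots> = (\<Sum>m<n. \<Sum>l<n. N $$ (k, l) * M $$ (l, m) * f m)"
    by (rule sum.swap)
  also have "\<dots> = (\<Sum>m<n. (N * M) $$ (k, m) * f m)"
  proof (rule sum.cong)
    fix m assume "m \<in> {..<n}"
    then have "(N * M) $$ (k, m) = (\<Sum>l<n. N $$ (k, l) * M $$ (l, m))"
      using assms(4) by (intro index_mult_square[OF assms(1,2)]) auto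
    then show "(\<Sum>l<n. N $$ (k, l) * M $$ (l, m) * f m) = (N * M) $$ (k, m) * f m"
      by (simp only: sum_distrib_right)
  qed simp
  also have "\<dots> = (\<Sum>m<n. if m = k then f m else 0)"
    using assms by (intro sum.cong) auto
  also have "\<dots> = f k"
    using assms by simp
  finally show ?thesis .
qed

lemma tensor_eqI:
  assumes "A \<in> carrier_tensor p q n" "B \<in> carrier_tensor p q n" "n > 0"
    and eq: "\<And>i. i < n \<Longrightarrow> L_trans A ! i = L_trans B ! i"
  shows "A = B"
proof -
  obtain N where N: "N \<in> carrier_mat n n" "M_mat n \<in> carrier_mat n n" "N * M_mat n = 1\<^sub>m n"
    by (rule M_mat_invertible)
  have recover: "(X ! k) $$ (i, j) = (\<Sum>l<n. N $$ (k, l) * (L_trans X ! l) $$ (i, j))"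
    if "X \<in> carrier_tensor p q n" "k < n" "i < p" "j < q" for X k i j
    using apply_mat_inverse[OF N that(2), of "\<lambda>l. (X ! l) $$ (i, j)"] that assms(3)
    by (simp add: L_trans_slice[OF that(1) assms(3)])
  show ?thesis
  proof (rule nth_equalityI)
    show "length A = length B" using assms(1,2) by (simp add: carrier_tensor_def)
    fix k assume "k < length A"
    then have k: "k < n" using assms(1) by (simp add: carrier_tensor_def)
    then have "A ! k \<in> carrier_mat p q" "B ! k \<in> carrier_mat p q"
      using assms(1,2) by (auto simp: carrier_tensor_def)
    then show "A ! k = B ! k"
      using k by (intro eq_matI) (auto simp: recover[OF assms(1)] recover[OF assms(2)] eq)
  qed
qed

text \<open>This discharges the definite descriptions that define the product, the conjugate transpose and
  the identity tensor.\<close>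

lemma tensor_with_slices:
  assumes "n > 0" and Y: "\<And>i. i < n \<Longrightarrow> Y i \<in> carrier_mat p q"
  shows "\<exists>!C. C \<in> carrier_tensor p q n \<and> (\<forall>i<n. L_trans C ! i = Y i)"
proof -
  obtain N where N: "M_mat n \<in> carrier_mat n n" "N \<in> carrier_mat n n" "M_mat n * N = 1\<^sub>m n"
    by (rule M_mat_invertible)
  define C where "C = map (\<lambda>k. mat p q (\<lambda>(i, j). \<Sum>l<n. N $$ (k, l) * Y l $$ (i, j))) [0..<n]"
  have C: "C \<in> carrier_tensor p q n"
    by (simp add: C_def carrier_tensor_def)
  moreover have "L_trans C ! k = Y k" if k: "k < n" for k
    using Y[OF k] apply_mat_inverse[OF N k] k
    unfolding L_trans_slice[OF C assms(1) k] by (intro eq_matI) (auto simp: C_def)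
  ultimately show ?thesis
    using tensor_eqI[OF _ _ assms(1)] by (intro ex1I[of _ C]) auto
qed

lemma c_prod_slices:
  assumes "A \<in> carrier_tensor p q n" "B \<in> carrier_tensor q s n" "n > 0"
  shows "A *\<^sub>c B \<in> carrier_tensor p s n"
    and "i < n \<Longrightarrow> L_trans (A *\<^sub>c B) ! i = L_trans A ! i * L_trans B ! i"
proof -
  have "\<exists>!C. C \<in> carrier_tensor p s n \<and> (\<forall>i<n. L_trans C ! i = L_trans A ! i * L_trans B ! i)"
    using assms by (intro tensor_with_slices mult_carrier_mat[of _ _ q] L_trans_slice_carrier)
  from theI'[OF this]
  show "A *\<^sub>c B \<in> carrier_tensor p s n"
    and "i < n \<Longrightarrow> L_trans (A *\<^sub>c B) ! i = L_trans A ! i * L_trans B ! i"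
    using assms by (auto simp: c_prod_def carrier_tensor_dims)
qed

lemma mat_adjoint_mat:
  "mat_adjoint A = mat (dim_col A) (dim_row A) (\<lambda>(i, j). conjugate (A $$ (j, i)))"
  by (rule eq_matI) (auto simp: mat_adjoint_def mat_of_rows_def)

lemma mat_adjoint_carrier:
  "A \<in> carrier_mat p q \<Longrightarrow> mat_adjoint A \<in> carrier_mat q p"
  by (simp add: mat_adjoint_mat)

lemma t_herm_slices:
  assumes "A \<in> carrier_tensor p q n" "n > 0"
  shows "t_herm A \<in> carrier_tensor q p n"
    and "i < n \<Longrightarrow> L_trans (t_herm A) ! i = mat_adjoint (L_trans A ! i)"
proof -
  have "\<exists>!C. C \<in> carrier_tensor q p n \<and> (\<forall>i<n. L_trans C ! i = mat_adjoint (L_trans A ! i))"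
    using assms by (intro tensor_with_slices mat_adjoint_carrier L_trans_slice_carrier)
  from theI'[OF this]
  show "t_herm A \<in> carrier_tensor q p n"
    and "i < n \<Longrightarrow> L_trans (t_herm A) ! i = mat_adjoint (L_trans A ! i)"
    using assms by (auto simp: t_herm_def carrier_tensor_dims)
qed

lemma t_one_slices:
  assumes "n > 0"
  shows "t_one p n \<in> carrier_tensor p p n"
    and "i < n \<Longrightarrow> L_trans (t_one p n) ! i = 1\<^sub>m p"
proof -
  have "\<exists>!C. C \<in> carrier_tensor p p n \<and> (\<forall>i<n. L_trans C ! i = 1\<^sub>m p)"
    using assms by (intro tensor_with_slices) auto
  from theI'[OF this]
  show "t_one p n \<in> carrier_tensor p p n"
    and "i < n \<Longrightarrow> L_trans (t_one p n) ! i = 1\<^sub>m p"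
    by (auto simp: t_one_def)
qed

lemma tplus_slices:
  assumes "A \<in> carrier_tensor p q n" "B \<in> carrier_tensor p q n" "n > 0"
  shows "A +\<^sub>c B \<in> carrier_tensor p q n"
    and "i < n \<Longrightarrow> L_trans (A +\<^sub>c B) ! i = L_trans A ! i + L_trans B ! i"
proof -
  show AB: "A +\<^sub>c B \<in> carrier_tensor p q n"
    using assms by (auto simp: carrier_tensor_def tplus_def)
  have "((A +\<^sub>c B) ! l) $$ (a, b) = (A ! l) $$ (a, b) + (B ! l) $$ (a, b)"
    if "l < n" "a < p" "b < q" for l a b
  proof -
    from assms that(1) have "A ! l \<in> carrier_mat p q" "B ! l \<in> carrier_mat p q"
      "(A +\<^sub>c B) ! l = A ! l + B ! l"
      by (auto simp: carrier_tensor_def tplus_def)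
    with that show ?thesis by simp
  qed
  then show "i < n \<Longrightarrow> L_trans (A +\<^sub>c B) ! i = L_trans A ! i + L_trans B ! i"
    unfolding L_trans_slice[OF AB assms(3)] L_trans_slice[OF assms(1,3)]
      L_trans_slice[OF assms(2,3)]
    by (intro eq_matI) (simp_all add: distrib_left sum.distrib)
qed

lemma tzero_slices:
  assumes "n > 0"
  shows "tzero p q n \<in> carrier_tensor p q n"
    and "i < n \<Longrightarrow> L_trans (tzero p q n) ! i = 0\<^sub>m p q"
proof -
  show Z: "tzero p q n \<in> carrier_tensor p q n"
    by (simp add: carrier_tensor_def tzero_def)
  show "i < n \<Longrightarrow> L_trans (tzero p q n) ! i = 0\<^sub>m p q"
    unfolding L_trans_slice[OF Z assms] by (intro eq_matI) (auto simp: tzero_def)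
qed

text \<open>The transform acts along the third mode only, so it commutes with forming blocks in the first
  two modes.\<close>

lemma tblock_slices:
  assumes "A \<in> carrier_tensor p q n" "B \<in> carrier_tensor p q' n"
    "C \<in> carrier_tensor p' q n" "D \<in> carrier_tensor p' q' n" "n > 0"
  shows "tblock A B C D \<in> carrier_tensor (p + p') (q + q') n"
    and "i < n \<Longrightarrow> L_trans (tblock A B C D) ! i =
      four_block_mat (L_trans A ! i) (L_trans B ! i) (L_trans C ! i) (L_trans D ! i)"
proof -
  show T: "tblock A B C D \<in> carrier_tensor (p + p') (q + q') n"
    using assms by (auto simp: carrier_tensor_def tblock_def)
  have "(tblock A B C D ! l) $$ (a, b) =
      (if a < p then if b < q then (A ! l) $$ (a, b) else (B ! l) $$ (a, b - q)
       else if b < q then (C ! l) $$ (a - p, b) else (D ! l) $$ (a - p, b - q))"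
    if "l < n" "a < p + p'" "b < q + q'" for l a b
  proof -
    from assms that(1) have "A ! l \<in> carrier_mat p q" "D ! l \<in> carrier_mat p' q'"
      "tblock A B C D ! l = four_block_mat (A ! l) (B ! l) (C ! l) (D ! l)"
      by (auto simp: carrier_tensor_def tblock_def)
    with that show ?thesis by simp
  qed
  then show "i < n \<Longrightarrow> L_trans (tblock A B C D) ! i =
      four_block_mat (L_trans A ! i) (L_trans B ! i) (L_trans C ! i) (L_trans D ! i)"
    unfolding L_trans_slice[OF T assms(5)] L_trans_slice[OF assms(1,5)]
      L_trans_slice[OF assms(2,5)] L_trans_slice[OF assms(3,5)] L_trans_slice[OF assms(4,5)]
    by (intro eq_matI) auto
qed

lemma t_inv_slices:
  assumes B: "B \<in> carrier_tensor p p n" "n > 0" and inv: "t_invertible B"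
  shows "t_inv B \<in> carrier_tensor p p n"
    and "i < n \<Longrightarrow> L_trans B ! i * L_trans (t_inv B) ! i = 1\<^sub>m p"
    and "i < n \<Longrightarrow> L_trans (t_inv B) ! i * L_trans B ! i = 1\<^sub>m p"
proof -
  have inverse: "X \<in> carrier_tensor p p n"
      "i < n \<Longrightarrow> L_trans B ! i * L_trans X ! i = 1\<^sub>m p"
      "i < n \<Longrightarrow> L_trans X ! i * L_trans B ! i = 1\<^sub>m p"
    if "is_t_inverse B X" for X i
  proof -
    from that B show X: "X \<in> carrier_tensor p p n"
      by (simp add: is_t_inverse_def carrier_tensor_dims)
    from that B have "B *\<^sub>c X = t_one p n" "X *\<^sub>c B = t_one p n"
      by (simp_all add: is_t_inverse_def carrier_tensor_dims)
    with c_prod_slices(2)[OF B(1) X B(2), of i] c_prod_slices(2)[OF X B(1) B(2), of i]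
    show "i < n \<Longrightarrow> L_trans B ! i * L_trans X ! i = 1\<^sub>m p"
      "i < n \<Longrightarrow> L_trans X ! i * L_trans B ! i = 1\<^sub>m p"
      using t_one_slices(2)[OF B(2)] by simp_all
  qed
  have "\<exists>!X. is_t_inverse B X"
  proof (rule ex_ex1I)
    show "\<exists>X. is_t_inverse B X" using inv by (simp add: t_invertible_def)
    fix X Y assume X: "is_t_inverse B X" and Y: "is_t_inverse B Y"
    show "X = Y"
    proof (rule tensor_eqI[OF inverse(1)[OF X] inverse(1)[OF Y] B(2)])
      fix i assume i: "i < n"
      note c = L_trans_slice_carrier[OF B i] L_trans_slice_carrier[OF inverse(1)[OF X] B(2) i]
        L_trans_slice_carrier[OF inverse(1)[OF Y] B(2) i]
      have "L_trans X ! i = L_trans X ! i * (L_trans B ! i * L_trans Y ! i)"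
        using c inverse(2)[OF Y i] by simp
      also have "\<dots> = L_trans X ! i * L_trans B ! i * L_trans Y ! i"
        using c by (simp add: assoc_mult_mat[of _ p p _ p _ p])
      also have "\<dots> = L_trans Y ! i"
        using c inverse(3)[OF X i] by simp
      finally show "L_trans X ! i = L_trans Y ! i" .
    qed
  qed
  then have "is_t_inverse B (t_inv B)"
    unfolding t_inv_def by (rule theI')
  from inverse[OF this] show "t_inv B \<in> carrier_tensor p p n"
    "i < n \<Longrightarrow> L_trans B ! i * L_trans (t_inv B) ! i = 1\<^sub>m p"
    "i < n \<Longrightarrow> L_trans (t_inv B) ! i * L_trans B ! i = 1\<^sub>m p"
    by simp_all
qed

section \<open>The Penrose equations for matrices\<close>

lemma mat_adjoint_mult:
  fixes A B :: "complex mat"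
  assumes "A \<in> carrier_mat p q" "B \<in> carrier_mat q s"
  shows "mat_adjoint (A * B) = mat_adjoint B * mat_adjoint A"
  using assms by (intro eq_matI)
    (auto simp: mat_adjoint_mat scalar_prod_def sum_conjugate conjugate_dist_mul mult.commute
      intro!: sum.cong)

lemma mat_adjoint_adjoint: "mat_adjoint (mat_adjoint (A :: complex mat)) = A"
  by (intro eq_matI) (auto simp: mat_adjoint_mat)

lemma mat_adjoint_four_block:
  fixes A B C D :: "complex mat"
  assumes "A \<in> carrier_mat p q" "B \<in> carrier_mat p q'"
    "C \<in> carrier_mat p' q" "D \<in> carrier_mat p' q'"
  shows "mat_adjoint (four_block_mat A B C D) =
    four_block_mat (mat_adjoint A) (mat_adjoint C) (mat_adjoint B) (mat_adjoint D)"
  using assms by (intro eq_matI) (auto simp: mat_adjoint_mat)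

lemma mat_adjoint_one: "mat_adjoint (1\<^sub>m n :: complex mat) = 1\<^sub>m n"
  by (intro eq_matI) (auto simp: mat_adjoint_mat)

lemma mat_adjoint_zero: "mat_adjoint (0\<^sub>m p q :: complex mat) = 0\<^sub>m q p"
  by (intro eq_matI) (auto simp: mat_adjoint_mat)

text \<open>Side conditions on dimensions alone let the simplifier reassociate long products, where carrier
  sets would leave it to guess the intermediate dimension.\<close>

lemma mult_assoc_dims:
  assumes "dim_col A = dim_row B" "dim_col B = dim_row C"
  shows "A * B * C = A * (B * C)"
  using assms by (intro assoc_mult_mat) auto

definition penrose_mat :: "complex mat \<Rightarrow> complex mat \<Rightarrow> bool" where
  "penrose_mat A X \<longleftrightarrow> A * X * A = A \<and> X * A * X = X \<and>
     mat_adjoint (A * X) = A * X \<and> mat_adjoint (X * A) = X * A"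

text \<open>\<open>A X\<close> and \<open>A Y\<close> are both the orthogonal projection onto the column space of \<open>A\<close>, hence equal;
  in the same way \<open>X A = Y A\<close>, and then \<open>X = X A X = Y A Y = Y\<close>.\<close>

lemma penrose_mat_unique:
  assumes c: "A \<in> carrier_mat p q" "X \<in> carrier_mat q p" "Y \<in> carrier_mat q p"
    and X: "penrose_mat A X" and Y: "penrose_mat A Y"
  shows "X = Y"
proof -
  have AX: "A * X = A * Y"
  proof -
    have "A * X = (A * Y * A) * X"
      using Y by (simp only: penrose_mat_def)
    also have "\<dots> = (A * Y) * (A * X)"
      using c by (simp add: mult_assoc_dims)
    also have "\<dots> = mat_adjoint ((A * X) * (A * Y))"
      using c X Y mat_adjoint_mult[of "A * X" p p "A * Y" p]
      by (simp only: penrose_mat_def mult_carrier_mat[of _ p q _ p])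
    also have "(A * X) * (A * Y) = (A * X * A) * Y"
      using c by (simp add: mult_assoc_dims)
    also have "\<dots> = A * Y"
      using X by (simp only: penrose_mat_def)
    finally show ?thesis using Y by (simp only: penrose_mat_def)
  qed
  have XA: "X * A = Y * A"
  proof -
    have "X * A = X * (A * Y * A)"
      using Y by (simp only: penrose_mat_def)
    also have "\<dots> = (X * A) * (Y * A)"
      using c by (simp add: mult_assoc_dims)
    also have "\<dots> = mat_adjoint ((Y * A) * (X * A))"
      using c X Y mat_adjoint_mult[of "Y * A" q q "X * A" q]
      by (simp only: penrose_mat_def mult_carrier_mat[of _ q p _ q])
    also have "(Y * A) * (X * A) = Y * (A * X * A)"
      using c by (simp add: mult_assoc_dims)
    also have "\<dots> = Y * A"
      using X by (simp only: penrose_mat_def)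
    finally show ?thesis using Y by (simp only: penrose_mat_def)
  qed
  have "X = X * A * X" using X by (simp only: penrose_mat_def)
  also have "\<dots> = Y * (A * X)" using c by (simp add: XA)
  also have "\<dots> = Y * A * Y" using c by (simp add: AX)
  also have "\<dots> = Y" using Y by (simp only: penrose_mat_def)
  finally show ?thesis .
qed

lemma unitary_conj_mult:
  fixes U :: "complex mat"
  assumes c: "U \<in> carrier_mat n n" "B \<in> carrier_mat n n" "C \<in> carrier_mat n n"
    and U: "mat_adjoint U * U = 1\<^sub>m n"
  shows "(U * B * mat_adjoint U) * (U * C * mat_adjoint U) = U * (B * C) * mat_adjoint U"
proof -
  note U' = mat_adjoint_carrier[OF c(1)]
  have "mat_adjoint U * (U * Z) = Z" if "Z \<in> carrier_mat n n" for Z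
  proof -
    have "mat_adjoint U * (U * Z) = mat_adjoint U * U * Z"
      using c U' that by simp
    also have "\<dots> = Z"
      using that by (simp only: U left_mult_one_mat)
    finally show ?thesis .
  qed
  then show ?thesis
    using c U' by (simp add: mult_assoc_dims mult_carrier_mat[of _ n n _ n])
qed

lemma mat_adjoint_unitary_conj:
  fixes U :: "complex mat"
  assumes c: "U \<in> carrier_mat n n" "B \<in> carrier_mat n n"
  shows "mat_adjoint (U * B * mat_adjoint U) = U * mat_adjoint B * mat_adjoint U"
  using c by (simp add: mat_adjoint_mult[of _ n n _ n] mat_adjoint_carrier mat_adjoint_adjoint
      mult_carrier_mat[of _ n n _ n] assoc_mult_mat[of _ n n _ n _ n])

lemma penrose_mat_unitary_conj:
  assumes c: "U \<in> carrier_mat n n" "B \<in> carrier_mat n n" "X \<in> carrier_mat n n"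
    and U: "mat_adjoint U * U = 1\<^sub>m n" and X: "penrose_mat B X"
  shows "penrose_mat (U * B * mat_adjoint U) (U * X * mat_adjoint U)"
proof -
  define f where "f Y = U * Y * mat_adjoint U" for Y
  have mult: "f Y * f Z = f (Y * Z)" if "Y \<in> carrier_mat n n" "Z \<in> carrier_mat n n" for Y Z
    unfolding f_def by (rule unitary_conj_mult[OF c(1) that U])
  have adj: "mat_adjoint (f Y) = f (mat_adjoint Y)" if "Y \<in> carrier_mat n n" for Y
    unfolding f_def by (rule mat_adjoint_unitary_conj[OF c(1) that])
  have "B * X \<in> carrier_mat n n" "X * B \<in> carrier_mat n n"
    using c by simp_all
  then have "penrose_mat (f B) (f X)"
    using c X by (simp only: penrose_mat_def mult adj)
  then show ?thesis by (simp only: f_def)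
qed

text \<open>The coisometry relation makes the product in one order the projection onto the first block,
  and cancelling \<open>T\<close> against \<open>S\<close> makes the product in the other order the Gram matrix of
  \<open>[K, L]\<close>.\<close>

lemma penrose_mat_hs_block:
  fixes S T K L :: "complex mat"
  assumes c: "S \<in> carrier_mat r r" "T \<in> carrier_mat r r" "K \<in> carrier_mat r r"
      "L \<in> carrier_mat r m"
    and ST: "S * T = 1\<^sub>m r" and TS: "T * S = 1\<^sub>m r"
    and KL: "K * mat_adjoint K + L * mat_adjoint L = 1\<^sub>m r"
  shows "penrose_mat (four_block_mat (S * K) (S * L) (0\<^sub>m m r) (0\<^sub>m m m))
    (four_block_mat (mat_adjoint K * T) (0\<^sub>m r m) (mat_adjoint L * T) (0\<^sub>m m m))"
    (is "penrose_mat ?B ?X")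
proof -
  note a = mat_adjoint_carrier[OF c(3)] mat_adjoint_carrier[OF c(4)]
  have "S * K * (mat_adjoint K * T) + S * L * (mat_adjoint L * T)
      = S * (K * mat_adjoint K + L * mat_adjoint L) * T"
  proof -
    have KK: "K * mat_adjoint K \<in> carrier_mat r r" "L * mat_adjoint L \<in> carrier_mat r r"
      using c a by simp_all
    have "S * (K * mat_adjoint K + L * mat_adjoint L) * T
      = S * (K * mat_adjoint K) * T + S * (L * mat_adjoint L) * T"
      using c KK by (simp only: mult_add_distrib_mat[of S r r _ r]
          add_mult_distrib_mat[of _ r r _ _ r] mult_carrier_mat[of _ r r _ r])
    then show ?thesis using c a by (simp add: mult_assoc_dims)
  qed
  also have "\<dots> = 1\<^sub>m r" using c by (simp only: KL ST right_mult_one_mat)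
  finally have BX: "?B * ?X = four_block_mat (1\<^sub>m r) (0\<^sub>m r m) (0\<^sub>m m r) (0\<^sub>m m m)"
    using c a by (subst mult_four_block_mat[of _ r r _ m _ m]) auto
  \<comment> \<open>The added zero block is what block multiplication leaves from the vanishing second blocks.\<close>
  have cancel: "P * T * (S * Z) + 0\<^sub>m p q = P * Z"
    if "P \<in> carrier_mat p r" "Z \<in> carrier_mat r q" for P Z :: "complex mat" and p q
  proof -
    have "P * T * (S * Z) = P * (T * S * Z)"
      using that c by (simp add: mult_assoc_dims)
    also have "\<dots> = P * Z"
      using that by (simp only: TS left_mult_one_mat)
    finally show ?thesis
      using that by (simp add: right_add_zero_mat[of _ p q] mult_carrier_mat[of _ p r _ q])
  qed
  have XB: "?X * ?B = four_block_mat (mat_adjoint K * K) (mat_adjoint K * L)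
      (mat_adjoint L * K) (mat_adjoint L * L)"
  proof (subst mult_four_block_mat[of _ r r _ m _ m])
    show "four_block_mat
        (mat_adjoint K * T * (S * K) + 0\<^sub>m r m * 0\<^sub>m m r)
        (mat_adjoint K * T * (S * L) + 0\<^sub>m r m * 0\<^sub>m m m)
        (mat_adjoint L * T * (S * K) + 0\<^sub>m m m * 0\<^sub>m m r)
        (mat_adjoint L * T * (S * L) + 0\<^sub>m m m * 0\<^sub>m m m)
      = four_block_mat (mat_adjoint K * K) (mat_adjoint K * L)
          (mat_adjoint L * K) (mat_adjoint L * L)"
      using cancel[OF a(1) c(3)] cancel[OF a(1) c(4)] cancel[OF a(2) c(3)] cancel[OF a(2) c(4)]
      by (simp only: left_mult_zero_mat[OF zero_carrier_mat])
  qed (use c a in auto)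
  have "?B * ?X * ?B = ?B"
    using c a unfolding BX by (subst mult_four_block_mat[of _ r r _ m _ m]) auto
  moreover have "?X * (?B * ?X) = ?X"
    using c a unfolding BX by (subst mult_four_block_mat[of _ r r _ m _ m]) auto
  moreover have "?X * ?B * ?X = ?X * (?B * ?X)"
    using c a by (intro assoc_mult_mat[of _ "r + m" "r + m" _ "r + m" _ "r + m"]
        four_block_carrier_mat) auto
  moreover have "mat_adjoint (?B * ?X) = ?B * ?X"
    unfolding BX by (subst mat_adjoint_four_block[of _ r r _ m _ m])
      (auto simp: mat_adjoint_one mat_adjoint_zero)
  moreover have "mat_adjoint (?X * ?B) = ?X * ?B"
    using c a unfolding XB
    by (subst mat_adjoint_four_block[of _ r r _ m _ m])
      (auto simp: mat_adjoint_mult[of _ r r _ r] mat_adjoint_mult[of _ r r _ m]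
        mat_adjoint_mult[of _ m r _ r] mat_adjoint_mult[of _ m r _ m] mat_adjoint_adjoint)
  ultimately show ?thesis unfolding penrose_mat_def by (simp only:)
qed

section \<open>The Moore-Penrose inverse of a tensor\<close>

lemma is_moore_penrose_iff_slices:
  assumes A: "A \<in> carrier_tensor p q n" and n: "n > 0"
  shows "is_moore_penrose A X \<longleftrightarrow> X \<in> carrier_tensor q p n \<and>
    (\<forall>i<n. penrose_mat (L_trans A ! i) (L_trans X ! i))"
proof (cases "X \<in> carrier_tensor q p n")
  case X: True
  have eq_iff: "B = C \<longleftrightarrow> (\<forall>i<n. L_trans B ! i = L_trans C ! i)"
    if "B \<in> carrier_tensor s t n" "C \<in> carrier_tensor s t n" for B C s t
    using tensor_eqI[OF that n] by auto
  note AX = c_prod_slices[OF A X n] and XA = c_prod_slices[OF X A n]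
  note AXA = c_prod_slices[OF AX(1) A n] and XAX = c_prod_slices[OF XA(1) X n]
  note hAX = t_herm_slices[OF AX(1) n] and hXA = t_herm_slices[OF XA(1) n]
  show ?thesis
    unfolding is_moore_penrose_def penrose_mat_def eq_iff[OF AXA(1) A] eq_iff[OF XAX(1) X]
      eq_iff[OF hAX(1) AX(1)] eq_iff[OF hXA(1) XA(1)]
    using A X n by (auto simp: carrier_tensor_dims AX XA AXA XAX hAX hXA)
next
  case False
  then show ?thesis using A n by (simp add: is_moore_penrose_def carrier_tensor_dims)
qed

lemma moore_penrose_eqI:
  assumes A: "A \<in> carrier_tensor p q n" and n: "n > 0" and X: "X \<in> carrier_tensor q p n"
    and P: "\<And>i. i < n \<Longrightarrow> penrose_mat (L_trans A ! i) (L_trans X ! i)"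
  shows "moore_penrose A = X"
  unfolding moore_penrose_def
proof (rule the_equality)
  show "is_moore_penrose A X"
    using assms by (simp add: is_moore_penrose_iff_slices)
  fix Y assume "is_moore_penrose A Y"
  then have Y: "Y \<in> carrier_tensor q p n"
    and PY: "\<And>i. i < n \<Longrightarrow> penrose_mat (L_trans A ! i) (L_trans Y ! i)"
    using A n by (simp_all add: is_moore_penrose_iff_slices)
  show "Y = X"
    using penrose_mat_unique[OF L_trans_slice_carrier[OF A n] L_trans_slice_carrier[OF Y n]
        L_trans_slice_carrier[OF X n] PY P]
    by (intro tensor_eqI[OF Y X n])
qed

theorem theorem3p10:
  fixes n1 n3 r :: nat and A U Sr K L :: tensor
  assumes "n3 > 0"
    and "A \<in> carrier_tensor n1 n1 n3"
    and "is_c_hs n1 n3 r A U Sr K L"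
  shows "moore_penrose A =
    U *\<^sub>c tblock (t_herm K *\<^sub>c t_inv Sr) (tzero r (n1 - r) n3)
               (t_herm L *\<^sub>c t_inv Sr) (tzero (n1 - r) (n1 - r) n3)
      *\<^sub>c t_herm U"
proof -
  note n = assms(1) and A = assms(2)
  define m where "m = n1 - r"
  from assms(3) have r: "r \<le> n1" and "t_unitary n1 n3 U"
    and S: "Sr \<in> carrier_tensor r r n3" and inv: "t_invertible Sr"
    and K: "K \<in> carrier_tensor r r n3" and L: "L \<in> carrier_tensor r m n3"
    and A_eq: "A = U *\<^sub>c tblock (Sr *\<^sub>c K) (Sr *\<^sub>c L) (tzero m r n3) (tzero m m n3) *\<^sub>c t_herm U"
    and KL: "K *\<^sub>c t_herm K +\<^sub>c L *\<^sub>c t_herm L = t_one r n3"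
    unfolding is_c_hs_def is_c_svd_def m_def by auto
  then have U: "U \<in> carrier_tensor n1 n1 n3" and UU: "t_herm U *\<^sub>c U = t_one n1 n3"
    by (auto simp: t_unitary_def)
  have rm: "r + m = n1" using r by (simp add: m_def)
  define T where "T = t_inv Sr"
  note T = t_inv_slices[OF S n inv, folded T_def]
  note hU = t_herm_slices[OF U n] and hK = t_herm_slices[OF K n] and hL = t_herm_slices[OF L n]
  note SK = c_prod_slices[OF S K n] and SL = c_prod_slices[OF S L n]
  note KT = c_prod_slices[OF hK(1) T(1) n] and LT = c_prod_slices[OF hL(1) T(1) n]
  note z = tzero_slices[OF n]
  note B = tblock_slices[where p = r and q = r and p' = m and q' = m, unfolded rm,
      OF SK(1) SL(1) z(1) z(1) n]
  note X = tblock_slices[where p = r and q = r and p' = m and q' = m, unfolded rm,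
      OF KT(1) z(1) LT(1) z(1) n]
  note UB = c_prod_slices[OF U B(1) n] and UX = c_prod_slices[OF U X(1) n]
  note UBU = c_prod_slices[OF UB(1) hU(1) n] and UXU = c_prod_slices[OF UX(1) hU(1) n]
  note KK = c_prod_slices[OF K hK(1) n] and LL = c_prod_slices[OF L hL(1) n]
  have "moore_penrose A = U *\<^sub>c tblock (t_herm K *\<^sub>c T) (tzero r m n3) (t_herm L *\<^sub>c T) (tzero m m n3)
      *\<^sub>c t_herm U"
  proof (rule moore_penrose_eqI[OF A n UXU(1)])
    fix i assume i: "i < n3"
    note slice = L_trans_slice_carrier[OF _ n i]
    have "mat_adjoint (L_trans U ! i) * L_trans U ! i = 1\<^sub>m n1"
      using arg_cong[OF UU, of "\<lambda>Y. L_trans Y ! i"] i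
      by (simp add: c_prod_slices(2)[OF hU(1) U n] hU t_one_slices(2)[OF n])
    moreover have "L_trans K ! i * mat_adjoint (L_trans K ! i)
        + L_trans L ! i * mat_adjoint (L_trans L ! i) = 1\<^sub>m r"
      using arg_cong[OF KL, of "\<lambda>Y. L_trans Y ! i"] i
      by (simp add: tplus_slices(2)[OF KK(1) LL(1) n] KK LL hK hL t_one_slices(2)[OF n])
    then have "penrose_mat (L_trans (tblock (Sr *\<^sub>c K) (Sr *\<^sub>c L) (tzero m r n3) (tzero m m n3)) ! i)
        (L_trans (tblock (t_herm K *\<^sub>c T) (tzero r m n3) (t_herm L *\<^sub>c T) (tzero m m n3)) ! i)"
      using penrose_mat_hs_block[OF slice[OF S] slice[OF T(1)] slice[OF K] slice[OF L] T(2)[OF i]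
          T(3)[OF i]] i
      by (simp add: B(2) X(2) SK(2) SL(2) KT(2) LT(2) hK(2) hL(2) z(2))
    ultimately have "penrose_mat
        (L_trans (U *\<^sub>c tblock (Sr *\<^sub>c K) (Sr *\<^sub>c L) (tzero m r n3) (tzero m m n3) *\<^sub>c t_herm U) ! i)
        (L_trans (U *\<^sub>c tblock (t_herm K *\<^sub>c T) (tzero r m n3) (t_herm L *\<^sub>c T) (tzero m m n3)
          *\<^sub>c t_herm U) ! i)"
      using penrose_mat_unitary_conj[OF slice[OF U] slice[OF B(1)] slice[OF X(1)]] i
      by (simp add: UBU(2) UXU(2) UB(2) UX(2) hU(2))
    then show "penrose_mat (L_trans A ! i)
        (L_trans (U *\<^sub>c tblock (t_herm K *\<^sub>c T) (tzero r m n3) (t_herm L *\<^sub>c T) (tzero m m n3)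
          *\<^sub>c t_herm U) ! i)"
      by (simp only: A_eq[symmetric])
  qed
  then show ?thesis by (simp only: T_def m_def)
qed

end
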